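(* Let $(A,\sigma)$ be a state-morphism BL-algebra with $\sigma$ radical-faithful. Then $(A,\sigma)$ is simple if and only if $A$ is a local BL-algebra and $\mathrm{Ker}(\sigma)=\mathrm{Rad}(A)$.
   Context: A BL-algebra is an algebra $(A,\wedge,\vee,\odot,\to,0,1)$ of type $(2,2,2,2,0,0)$ such that $(A,\wedge,\vee,0,1)$ is a bounded lattice, $(A,\odot,1)$ is a commutative monoid, and for all $a,b,c\in A$: $c\le a\to b$ iff $a\odot c\le b$; $a\wedge b=a\odot(a\to b)$; $(a\to b)\vee(b\to a)=1$. A morphism-state-operator on $A$ is a map $\sigma:A\to A$ such that for all $x,y\in A$: $\sigma(0)=0$; $\sigma(x\to y)=\sigma(x)\to\sigma(x\wedge y)$; $\sigma(\sigma(x)\odot\sigma(y))=\sigma(x)\odot\sigma(y)$; $\sigma(\sigma(x)\to\sigma(y))=\sigma(x)\to\sigma(y)$; $\sigma(x\odot y)=\sigma(x)\odot\sigma(y)$; then $(A,\sigma)$ is a state-morphism BL-algebra. The image $\sigma(A)$ is a subalgebra of $A$, regarded as a BL-algebra. $\mathrm{Ker}(\sigma)=\{x\in A:\sigma(x)=1\}$. A filter is a nonempty subset closed under $\odot$ and upward closed; a maximal filter is a proper filter not strictly contained in another proper filter; $\mathrm{Rad}(A)$ is the intersection of all maximal filters of $A$. A BL-algebra is local if it has exactly one maximal filter, and simple if it has exactly two filters. The state BL-algebra $(A,\sigma)$ is simple if $\sigma(A)$ is simple. $\sigma$ is radical-faithful if for every $x\in A$, $\sigma(x)\in\mathrm{Rad}(A)$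 implies $x\in\mathrm{Rad}(A)$. *)

theory Defs
  imports "HOL-Algebra.Group"
begin

text \<open>
  BL-algebras are carrier-based, because the image of a state-morphism-operator has to be
  treated as a BL-algebra in its own right. The record extends \<^typ>\<open>'a monoid\<close>, so the monoid
  operation (usually written \<open>\<odot>\<close>) is \<open>\<otimes>\<close> and the unit, which is also the top element, is \<open>\<one>\<close>.
\<close>

record 'a bl_struct = "'a monoid" +
  bl_meet :: "'a \<Rightarrow> 'a \<Rightarrow> 'a" (infixl "\<^bold>\<and>\<index>" 70)
  bl_join :: "'a \<Rightarrow> 'a \<Rightarrow> 'a" (infixl "\<^bold>\<or>\<index>" 65)
  bl_imp :: "'a \<Rightarrow> 'a \<Rightarrow> 'a" (infixr "\<rightharpoonup>\<index>" 60)
  bl_zero :: 'a ("\<zero>\<index>")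

definition bl_le :: "('a, 'm) bl_struct_scheme \<Rightarrow> 'a \<Rightarrow> 'a \<Rightarrow> bool" (infix "\<preceq>\<index>" 50)
  where "x \<preceq>\<^bsub>A\<^esub> y \<longleftrightarrow> x \<^bold>\<and>\<^bsub>A\<^esub> y = x"

locale bl_algebra = comm_monoid A for A :: "('a, 'm) bl_struct_scheme" (structure) +
  assumes meet_closed: "\<lbrakk>x \<in> carrier A; y \<in> carrier A\<rbrakk> \<Longrightarrow> x \<^bold>\<and> y \<in> carrier A"
    and join_closed: "\<lbrakk>x \<in> carrier A; y \<in> carrier A\<rbrakk> \<Longrightarrow> x \<^bold>\<or> y \<in> carrier A"
    and imp_closed: "\<lbrakk>x \<in> carrier A; y \<in> carrier A\<rbrakk> \<Longrightarrow> x \<rightharpoonup> y \<in> carrier A"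
    and zero_closed: "\<zero> \<in> carrier A"
    and meet_assoc: "\<lbrakk>x \<in> carrier A; y \<in> carrier A; z \<in> carrier A\<rbrakk>
      \<Longrightarrow> (x \<^bold>\<and> y) \<^bold>\<and> z = x \<^bold>\<and> (y \<^bold>\<and> z)"
    and join_assoc: "\<lbrakk>x \<in> carrier A; y \<in> carrier A; z \<in> carrier A\<rbrakk>
      \<Longrightarrow> (x \<^bold>\<or> y) \<^bold>\<or> z = x \<^bold>\<or> (y \<^bold>\<or> z)"
    and meet_comm: "\<lbrakk>x \<in> carrier A; y \<in> carrier A\<rbrakk> \<Longrightarrow> x \<^bold>\<and> y = y \<^bold>\<and> x"
    and join_comm: "\<lbrakk>x \<in> carrier A; y \<in> carrier A\<rbrakk> \<Longrightarrow> x \<^bold>\<or> y = y \<^bold>\<or> x"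
    and meet_join_absorb: "\<lbrakk>x \<in> carrier A; y \<in> carrier A\<rbrakk> \<Longrightarrow> x \<^bold>\<and> (x \<^bold>\<or> y) = x"
    and join_meet_absorb: "\<lbrakk>x \<in> carrier A; y \<in> carrier A\<rbrakk> \<Longrightarrow> x \<^bold>\<or> (x \<^bold>\<and> y) = x"
    and zero_least: "x \<in> carrier A \<Longrightarrow> \<zero> \<preceq> x"
    and one_greatest: "x \<in> carrier A \<Longrightarrow> x \<preceq> \<one>"
    and residuation: "\<lbrakk>a \<in> carrier A; b \<in> carrier A; c \<in> carrier A\<rbrakk>
      \<Longrightarrow> c \<preceq> a \<rightharpoonup> b \<longleftrightarrow> a \<otimes> c \<preceq> b"
    and divisibility: "\<lbrakk>a \<in> carrier A; b \<in> carrier A\<rbrakk> \<Longrightarrow> a \<^bold>\<and> b = a \<otimes> (a \<rightharpoonup> b)"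
    and prelinearity: "\<lbrakk>a \<in> carrier A; b \<in> carrier A\<rbrakk> \<Longrightarrow> (a \<rightharpoonup> b) \<^bold>\<or> (b \<rightharpoonup> a) = \<one>"

definition bl_filter :: "('a, 'm) bl_struct_scheme \<Rightarrow> 'a set \<Rightarrow> bool"
  where "bl_filter A F \<longleftrightarrow> F \<noteq> {} \<and> F \<subseteq> carrier A
    \<and> (\<forall>x\<in>F. \<forall>y\<in>F. x \<otimes>\<^bsub>A\<^esub> y \<in> F)
    \<and> (\<forall>x\<in>F. \<forall>y\<in>carrier A. x \<preceq>\<^bsub>A\<^esub> y \<longrightarrow> y \<in> F)"

definition bl_proper_filter :: "('a, 'm) bl_struct_scheme \<Rightarrow> 'a set \<Rightarrow> bool"
  where "bl_proper_filter A F \<longleftrightarrow> bl_filter A F \<and> F \<noteq> carrier A"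

definition bl_maximal_filter :: "('a, 'm) bl_struct_scheme \<Rightarrow> 'a set \<Rightarrow> bool"
  where "bl_maximal_filter A F \<longleftrightarrow> bl_proper_filter A F
    \<and> \<not> (\<exists>G. bl_proper_filter A G \<and> F \<subset> G)"

text \<open>Intersecting inside the carrier matters only for the one-element algebra, which has no
  maximal filter and hence is its own radical.\<close>

definition bl_Rad :: "('a, 'm) bl_struct_scheme \<Rightarrow> 'a set"
  where "bl_Rad A = carrier A \<inter> \<Inter> {F. bl_maximal_filter A F}"

definition bl_local :: "('a, 'm) bl_struct_scheme \<Rightarrow> bool"
  where "bl_local A \<longleftrightarrow> (\<exists>!F. bl_maximal_filter A F)"

definition bl_simple :: "('a, 'm) bl_struct_scheme \<Rightarrow> bool"
  where "bl_simple A \<longleftrightarrow> card {F. bl_filter A F} = 2"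

locale state_morphism_bl_algebra = bl_algebra A
  for A :: "('a, 'm) bl_struct_scheme" (structure) and \<sigma> :: "'a \<Rightarrow> 'a" +
  assumes sigma_closed: "\<sigma> \<in> carrier A \<rightarrow> carrier A"
    and sigma_zero: "\<sigma> \<zero> = \<zero>"
    and sigma_imp: "\<lbrakk>x \<in> carrier A; y \<in> carrier A\<rbrakk> \<Longrightarrow> \<sigma> (x \<rightharpoonup> y) = \<sigma> x \<rightharpoonup> \<sigma> (x \<^bold>\<and> y)"
    and sigma_sigma_mult: "\<lbrakk>x \<in> carrier A; y \<in> carrier A\<rbrakk> \<Longrightarrow> \<sigma> (\<sigma> x \<otimes> \<sigma> y) = \<sigma> x \<otimes> \<sigma> y"
    and sigma_sigma_imp: "\<lbrakk>x \<in> carrier A; y \<in> carrier A\<rbrakk>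
      \<Longrightarrow> \<sigma> (\<sigma> x \<rightharpoonup> \<sigma> y) = \<sigma> x \<rightharpoonup> \<sigma> y"
    and sigma_mult: "\<lbrakk>x \<in> carrier A; y \<in> carrier A\<rbrakk> \<Longrightarrow> \<sigma> (x \<otimes> y) = \<sigma> x \<otimes> \<sigma> y"

definition state_Ker :: "('a, 'm) bl_struct_scheme \<Rightarrow> ('a \<Rightarrow> 'a) \<Rightarrow> 'a set"
  where "state_Ker A \<sigma> = {x \<in> carrier A. \<sigma> x = \<one>\<^bsub>A\<^esub>}"

definition state_image :: "('a, 'm) bl_struct_scheme \<Rightarrow> ('a \<Rightarrow> 'a) \<Rightarrow> ('a, 'm) bl_struct_scheme"
  where "state_image A \<sigma> = A\<lparr>carrier := \<sigma> ` carrier A\<rparr>"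

definition state_simple :: "('a, 'm) bl_struct_scheme \<Rightarrow> ('a \<Rightarrow> 'a) \<Rightarrow> bool"
  where "state_simple A \<sigma> \<longleftrightarrow> bl_simple (state_image A \<sigma>)"

definition radical_faithful :: "('a, 'm) bl_struct_scheme \<Rightarrow> ('a \<Rightarrow> 'a) \<Rightarrow> bool"
  where "radical_faithful A \<sigma> \<longleftrightarrow> (\<forall>x\<in>carrier A. \<sigma> x \<in> bl_Rad A \<longrightarrow> x \<in> bl_Rad A)"

context bl_algebra
begin

lemma le_trans:
  assumes "x \<in> carrier A" "y \<in> carrier A" "z \<in> carrier A" "x \<preceq> y" "y \<preceq> z"
  shows "x \<preceq> z"
  using assms meet_assoc by (metis bl_le_def)

lemma le_antisym: "\<lbrakk>x \<in> carrier A; y \<in> carrier A; x \<preceq> y; y \<preceq> x\<rbrakk> \<Longrightarrow> x = y"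
  using meet_comm by (metis bl_le_def)

lemma le_refl: "x \<in> carrier A \<Longrightarrow> x \<preceq> x"
  by (metis bl_le_def join_meet_absorb meet_join_absorb meet_closed)

lemma meet_lower: "\<lbrakk>x \<in> carrier A; y \<in> carrier A\<rbrakk> \<Longrightarrow> x \<^bold>\<and> y \<preceq> y"
  by (metis bl_le_def le_refl meet_assoc)

lemma meet_greatest:
  "\<lbrakk>x \<in> carrier A; y \<in> carrier A; z \<in> carrier A; z \<preceq> x; z \<preceq> y\<rbrakk> \<Longrightarrow> z \<preceq> x \<^bold>\<and> y"
  by (metis bl_le_def meet_assoc)

lemma join_upper: "\<lbrakk>x \<in> carrier A; y \<in> carrier A\<rbrakk> \<Longrightarrow> x \<preceq> x \<^bold>\<or> y"
  by (simp add: bl_le_def meet_join_absorb)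

lemma le_join: "\<lbrakk>x \<in> carrier A; y \<in> carrier A\<rbrakk> \<Longrightarrow> x \<preceq> y \<longleftrightarrow> x \<^bold>\<or> y = y"
  by (metis bl_le_def join_comm join_meet_absorb meet_comm meet_join_absorb)

lemma join_least:
  "\<lbrakk>x \<in> carrier A; y \<in> carrier A; z \<in> carrier A; x \<preceq> z; y \<preceq> z\<rbrakk> \<Longrightarrow> x \<^bold>\<or> y \<preceq> z"
  by (metis join_assoc join_closed le_join)

lemma modus_ponens: "\<lbrakk>x \<in> carrier A; y \<in> carrier A\<rbrakk> \<Longrightarrow> x \<otimes> (x \<rightharpoonup> y) \<preceq> y"
  by (metis divisibility meet_lower)

lemma mult_le: "\<lbrakk>x \<in> carrier A; y \<in> carrier A\<rbrakk> \<Longrightarrow> x \<otimes> y \<preceq> x"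
proof -
  assume xy: "x \<in> carrier A" "y \<in> carrier A"
  have "\<one> \<preceq> x \<rightharpoonup> x" using xy by (simp add: residuation le_refl)
  then have "y \<preceq> x \<rightharpoonup> x" using xy by (meson imp_closed le_trans one_closed one_greatest)
  then show ?thesis using xy by (simp add: residuation)
qed

lemma join_le_imp_imp:
  assumes "x \<in> carrier A" "y \<in> carrier A"
  shows "x \<^bold>\<or> y \<preceq> (x \<rightharpoonup> y) \<rightharpoonup> y"
proof (rule join_least)
  show "x \<preceq> (x \<rightharpoonup> y) \<rightharpoonup> y"
    using assms by (simp add: residuation imp_closed m_comm modus_ponens)
  show "y \<preceq> (x \<rightharpoonup> y) \<rightharpoonup> y"
    using assms by (simp add: residuation imp_closed m_comm mult_le)
qed (use assms imp_closed in auto)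

lemma join_eq:
  assumes "x \<in> carrier A" "y \<in> carrier A"
  shows "x \<^bold>\<or> y = ((x \<rightharpoonup> y) \<rightharpoonup> y) \<^bold>\<and> ((y \<rightharpoonup> x) \<rightharpoonup> x)" (is "_ = ?t")
proof (rule le_antisym)
  have c: "?t \<in> carrier A" "x \<^bold>\<or> y \<in> carrier A" "x \<rightharpoonup> y \<in> carrier A" "y \<rightharpoonup> x \<in> carrier A"
    "(x \<rightharpoonup> y) \<rightharpoonup> y \<in> carrier A" "(y \<rightharpoonup> x) \<rightharpoonup> x \<in> carrier A"
    using assms by (simp_all add: imp_closed meet_closed join_closed)
  show "?t \<in> carrier A" "x \<^bold>\<or> y \<in> carrier A" by fact+
  show "x \<^bold>\<or> y \<preceq> ?t"
    using assms c join_le_imp_imp join_comm by (metis meet_greatest)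
  have "?t \<preceq> (x \<rightharpoonup> y) \<rightharpoonup> y" "?t \<preceq> (y \<rightharpoonup> x) \<rightharpoonup> x"
    using c by (metis meet_comm meet_lower)+
  then have "(x \<rightharpoonup> y) \<otimes> ?t \<preceq> y" "(y \<rightharpoonup> x) \<otimes> ?t \<preceq> x"
    using assms c by (simp_all add: residuation)
  then have "?t \<otimes> (x \<rightharpoonup> y) \<preceq> x \<^bold>\<or> y" "?t \<otimes> (y \<rightharpoonup> x) \<preceq> x \<^bold>\<or> y"
    using assms c by (metis join_comm join_upper le_trans m_closed m_comm)+
  then have "x \<rightharpoonup> y \<preceq> ?t \<rightharpoonup> (x \<^bold>\<or> y)" "y \<rightharpoonup> x \<preceq> ?t \<rightharpoonup> (x \<^bold>\<or> y)"
    using assms c by (simp_all add: residuation)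
  then have "\<one> \<preceq> ?t \<rightharpoonup> (x \<^bold>\<or> y)"
    using assms c join_least prelinearity imp_closed by metis
  then show "?t \<preceq> x \<^bold>\<or> y"
    using c by (simp add: residuation)
qed

end

lemma (in state_morphism_bl_algebra) state_image_bl_algebra: "bl_algebra (state_image A \<sigma>)"
proof -
  let ?S = "\<sigma> ` carrier A"
  have sub: "x \<in> carrier A" if "x \<in> ?S" for x
    using that sigma_closed by auto
  have imp: "x \<rightharpoonup> y \<in> ?S" if xy: "x \<in> ?S" "y \<in> ?S" for x y
  proof -
    obtain u v where uv: "u \<in> carrier A" "v \<in> carrier A" "x = \<sigma> u" "y = \<sigma> v" using xy by auto
    then have "x \<rightharpoonup> y = \<sigma> (x \<rightharpoonup> y)" by (simp add: sigma_sigma_imp)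
    then show ?thesis using xy sub imp_closed by blast
  qed
  have mult: "x \<otimes> y \<in> ?S" if xy: "x \<in> ?S" "y \<in> ?S" for x y
  proof -
    obtain u v where uv: "u \<in> carrier A" "v \<in> carrier A" "x = \<sigma> u" "y = \<sigma> v" using xy by auto
    then have "x \<otimes> y = \<sigma> (x \<otimes> y)" by (simp add: sigma_sigma_mult)
    then show ?thesis using xy sub m_closed by blast
  qed
  have zero: "\<zero> \<in> ?S"
    by (metis imageI sigma_zero zero_closed)
  have "\<zero> \<rightharpoonup> \<zero> = \<one>"
    by (metis imp_closed le_antisym le_refl one_closed one_greatest r_one residuation zero_closed)
  then have one: "\<one> \<in> ?S" using imp[OF zero zero] by simp
  have meet: "x \<^bold>\<and> y \<in> ?S" if "x \<in> ?S" "y \<in> ?S" for x y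
    using that by (simp add: divisibility sub imp mult del: image_iff)
  have join: "x \<^bold>\<or> y \<in> ?S" if "x \<in> ?S" "y \<in> ?S" for x y
    using that by (simp add: join_eq sub imp meet del: image_iff)
  have comm: "x \<otimes> y = y \<otimes> x" "x \<^bold>\<and> y = y \<^bold>\<and> x" "x \<^bold>\<or> y = y \<^bold>\<or> x" if "x \<in> ?S" "y \<in> ?S" for x y
    using that sub m_comm meet_comm join_comm by auto
  show ?thesis
    by (unfold_locales;
     ((simp add: state_image_def bl_le_def comm del: image_iff; fail) |
      (simp add: state_image_def bl_le_def sub imp mult zero one meet join m_assoc
        meet_assoc join_assoc meet_join_absorb join_meet_absorb prelinearity
        divisibility[symmetric]
        zero_least[unfolded bl_le_def] one_greatest[unfolded bl_le_def]
        residuation[unfolded bl_le_def] del: image_iff)))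
qed

end

theory Submission
  imports Defs
begin

text \<open>
  Filters of \<open>\<sigma>(A)\<close> and filters of \<open>A\<close> above \<open>Ker \<sigma>\<close> are compared by pulling back along \<open>\<sigma>\<close>, and
  by taking the upward closure in \<open>\<sigma>(A)\<close> of the image of a filter. If the closure of \<open>\<sigma>(G)\<close> is
  improper, then \<open>\<sigma> g = 0\<close> for some \<open>g \<in> G\<close>, so the negation of \<open>g\<close> lies in \<open>Ker \<sigma>\<close> and \<open>G\<close> is
  improper too. Hence \<open>\<sigma>(A)\<close> is simple iff \<open>Ker \<sigma>\<close> is a maximal filter. Radical-faithfulness yields
  \<open>Ker \<sigma> \<subseteq> Rad A\<close>, so that a maximal \<open>Ker \<sigma>\<close> is contained in, hence equal to, every maximal filter.
\<close>

lemma
  assumes "bl_filter A F"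
  shows bl_filter_subset: "x \<in> F \<Longrightarrow> x \<in> carrier A"
    and bl_filter_mult: "\<lbrakk>x \<in> F; y \<in> F\<rbrakk> \<Longrightarrow> x \<otimes>\<^bsub>A\<^esub> y \<in> F"
    and bl_filter_up: "\<lbrakk>x \<in> F; y \<in> carrier A; x \<preceq>\<^bsub>A\<^esub> y\<rbrakk> \<Longrightarrow> y \<in> F"
  using assms unfolding bl_filter_def by blast+

section \<open>Filters and order in a single BL-algebra\<close>

context bl_algebra
begin

lemma bl_filter_one: "bl_filter A F \<Longrightarrow> \<one> \<in> F"
  unfolding bl_filter_def using one_greatest by blast

lemma bl_filter_zero_iff:
  assumes "bl_filter A F"
  shows "\<zero> \<in> F \<longleftrightarrow> F = carrier A"
proof
  assume "\<zero> \<in> F"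
  then have "carrier A \<subseteq> F"
    using bl_filter_up[OF assms, of \<zero>] zero_least by blast
  then show "F = carrier A"
    using bl_filter_subset[OF assms] by blast
qed (simp add: zero_closed)

lemma le_zero_iff: "x \<in> carrier A \<Longrightarrow> x \<preceq> \<zero> \<longleftrightarrow> x = \<zero>"
  using le_antisym[of x \<zero>] le_refl[of \<zero>] by (auto simp: zero_least zero_closed)

lemma mult_mono:
  assumes "x \<in> carrier A" "y \<in> carrier A" "u \<in> carrier A" "v \<in> carrier A" "x \<preceq> u" "y \<preceq> v"
  shows "x \<otimes> y \<preceq> u \<otimes> v"
proof -
  \<comment> \<open>By residuation, \<open>c\<close> lies below
    \<open>a \<rightharpoonup> (a \<otimes> c)\<close>, hence so does \<open>b\<close>; residuate
    back. Commutativity then gives the other argument.\<close>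
  have *: "a \<otimes> b \<preceq> a \<otimes> c" if "a \<in> carrier A" "b \<in> carrier A" "c \<in> carrier A" "b \<preceq> c" for a b c
  proof -
    have "c \<preceq> a \<rightharpoonup> (a \<otimes> c)" using that by (simp add: residuation le_refl)
    then have "b \<preceq> a \<rightharpoonup> (a \<otimes> c)" using that le_trans[of b c] by (simp add: imp_closed)
    then show ?thesis using that by (simp add: residuation)
  qed
  have "x \<otimes> y \<preceq> x \<otimes> v" using assms *[of x y v] by simp
  moreover have "x \<otimes> v \<preceq> u \<otimes> v" using assms *[of v x u] by (simp add: m_comm)
  ultimately show ?thesis using assms le_trans[of "x \<otimes> y" "x \<otimes> v"] by simp
qed

lemma imp_self: "x \<in> carrier A \<Longrightarrow> x \<rightharpoonup> x = \<one>"
  using residuation[of x x \<one>] le_refl[of x] le_antisym[of "x \<rightharpoonup> x" \<one>]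
  by (simp add: imp_closed one_greatest)

lemma bl_filter_singleton_one: "bl_filter A {\<one>}"
  unfolding bl_filter_def using le_antisym[of \<one>] one_greatest by auto

lemma bl_filter_carrier: "bl_filter A (carrier A)"
  unfolding bl_filter_def by auto

text \<open>The singleton of the unit and the whole carrier are always filters, and they differ iff
  \<open>\<zero> \<noteq> \<one>\<close>. Having exactly two filters therefore means that these two
  are distinct and are the only ones.\<close>

lemma bl_simple_iff:
  "bl_simple A \<longleftrightarrow> \<zero> \<noteq> \<one> \<and> (\<forall>F. bl_filter A F \<longrightarrow> F = {\<one>} \<or> F = carrier A)"
proof -
  have ne: "{\<one>} = carrier A \<longleftrightarrow> \<zero> = \<one>"
    using bl_filter_zero_iff[OF bl_filter_singleton_one] by auto
  show ?thesis
  proof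
    assume "bl_simple A"
    then obtain F G where FG: "{F. bl_filter A F} = {F, G}" "F \<noteq> G"
      unfolding bl_simple_def card_2_iff by blast
    have "\<zero> \<noteq> \<one>"
    proof
      assume "\<zero> = \<one>"
      \<comment> \<open>Every filter contains \<open>\<one>\<close>, which now is
        \<open>\<zero>\<close>, so only one filter remains, against
        \<open>F \<noteq> G\<close>.\<close>
      then have "H = carrier A" if "bl_filter A H" for H
        using that bl_filter_one bl_filter_zero_iff by metis
      then show False using FG by blast
    qed
    then have ne': "{\<one>} \<noteq> carrier A" using ne by simp
    have "{\<one>} \<in> {F, G}" "carrier A \<in> {F, G}"
      unfolding FG(1)[symmetric] by (simp_all add: bl_filter_singleton_one bl_filter_carrier)
    then have "{F, G} = {{\<one>}, carrier A}" using ne' by auto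
    then have "bl_filter A F \<longleftrightarrow> F \<in> {{\<one>}, carrier A}" for F
      using FG(1) by (metis mem_Collect_eq)
    with \<open>\<zero> \<noteq> \<one>\<close> show "\<zero> \<noteq> \<one> \<and> (\<forall>F. bl_filter A F \<longrightarrow> F = {\<one>} \<or> F = carrier A)"
      by auto
  next
    assume "\<zero> \<noteq> \<one> \<and> (\<forall>F. bl_filter A F \<longrightarrow> F = {\<one>} \<or> F = carrier A)"
    then have "F \<in> {F. bl_filter A F} \<longleftrightarrow> F \<in> {{\<one>}, carrier A}" "{\<one>} \<noteq> carrier A" for F
      using bl_filter_singleton_one bl_filter_carrier ne by auto
    then have "{F. bl_filter A F} = {{\<one>}, carrier A}" "{\<one>} \<noteq> carrier A" by blast+
    then show "bl_simple A" unfolding bl_simple_def by simp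
  qed
qed

end

section \<open>The operator, its kernel and the filters of its image\<close>

context state_morphism_bl_algebra
begin

lemma sigma_mem: "x \<in> carrier A \<Longrightarrow> \<sigma> x \<in> carrier A"
  using sigma_closed by auto

lemma sigma_one: "\<sigma> \<one> = \<one>"
  using sigma_imp[of \<zero> \<zero>] le_refl[of \<zero>]
  by (simp add: zero_closed imp_self sigma_zero bl_le_def)

text \<open>Divisibility turns \<open>x \<preceq> y\<close> into a factorisation of \<open>x\<close>
  with factor \<open>y\<close>; since \<open>\<sigma>\<close> is multiplicative,
  \<open>\<sigma> y\<close> is a factor of \<open>\<sigma> x\<close>, and a product lies below its
  factors.\<close>

lemma sigma_mono:
  assumes "x \<in> carrier A" "y \<in> carrier A" "x \<preceq> y"
  shows "\<sigma> x \<preceq> \<sigma> y"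
proof -
  have "x = y \<otimes> (y \<rightharpoonup> x)"
    using assms by (metis bl_le_def divisibility meet_comm)
  then have "\<sigma> x = \<sigma> y \<otimes> \<sigma> (y \<rightharpoonup> x)"
    using assms by (metis imp_closed sigma_mult)
  then show ?thesis using assms by (simp add: mult_le sigma_mem imp_closed)
qed

lemma sigma_neg:
  assumes "x \<in> carrier A"
  shows "\<sigma> (x \<rightharpoonup> \<zero>) = \<sigma> x \<rightharpoonup> \<zero>"
proof -
  have "x \<^bold>\<and> \<zero> = \<zero>"
    using assms zero_least[of x] meet_comm[of x \<zero>] zero_closed by (simp add: bl_le_def)
  then show ?thesis using assms sigma_imp[of x \<zero>] by (simp add: sigma_zero zero_closed)
qed

lemma bl_filter_state_Ker: "bl_filter A (state_Ker A \<sigma>)"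
  unfolding bl_filter_def
proof (intro conjI ballI impI)
  show "state_Ker A \<sigma> \<noteq> {}" "state_Ker A \<sigma> \<subseteq> carrier A"
    using sigma_one by (auto simp: state_Ker_def)
  show "x \<otimes> y \<in> state_Ker A \<sigma>" if "x \<in> state_Ker A \<sigma>" "y \<in> state_Ker A \<sigma>" for x y
    using that by (simp add: state_Ker_def sigma_mult)
  show "y \<in> state_Ker A \<sigma>" if "x \<in> state_Ker A \<sigma>" "y \<in> carrier A" "x \<preceq> y" for x y
  proof -
    have "\<one> \<preceq> \<sigma> y" using that sigma_mono[of x y] by (simp add: state_Ker_def)
    then have "\<sigma> y = \<one>" using that by (simp add: le_antisym one_greatest sigma_mem)
    then show ?thesis using that by (simp add: state_Ker_def)
  qed
qed

text \<open>Passing to the image changes only the carrier, so products and order can be taken in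
  \<open>A\<close>.\<close>

lemma bl_filter_state_image_iff:
  "bl_filter (state_image A \<sigma>) F \<longleftrightarrow> F \<noteq> {} \<and> F \<subseteq> \<sigma> ` carrier A
    \<and> (\<forall>x\<in>F. \<forall>y\<in>F. x \<otimes> y \<in> F) \<and> (\<forall>x\<in>F. \<forall>y\<in>\<sigma> ` carrier A. x \<preceq> y \<longrightarrow> y \<in> F)"
  unfolding bl_filter_def state_image_def bl_le_def by simp

lemma state_simple_iff:
  "state_simple A \<sigma> \<longleftrightarrow> \<zero> \<noteq> \<one> \<and>
    (\<forall>F. bl_filter (state_image A \<sigma>) F \<longrightarrow> F = {\<one>} \<or> F = \<sigma> ` carrier A)"
  unfolding state_simple_def bl_algebra.bl_simple_iff[OF state_image_bl_algebra]
  by (simp add: state_image_def)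

lemma bl_filter_vimage:
  assumes "bl_filter (state_image A \<sigma>) F"
  shows "bl_filter A {x \<in> carrier A. \<sigma> x \<in> F}"
proof -
  note F = assms[unfolded bl_filter_state_image_iff]
  \<comment> \<open>The unit is its own image and lies above any \<open>s\<close>, so it belongs to
    \<open>F\<close>; this makes the preimage nonempty.\<close>
  obtain s where "s \<in> F" "s \<in> \<sigma> ` carrier A" using F by blast
  then have "\<one> \<in> F"
    using F one_greatest sigma_mem sigma_one by (metis image_iff one_closed)
  then show ?thesis
    unfolding bl_filter_def using F sigma_one sigma_mono by (auto simp: sigma_mult)
qed

text \<open>Closing upwards inside the image builds in upward closure. Products survive because the
  lower bounds multiply:
  \<open>\<sigma> (g \<otimes> h) = \<sigma> g \<otimes> \<sigma> h\<close>.\<close>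

lemma bl_filter_image_up:
  assumes G: "bl_filter A G"
  shows "bl_filter (state_image A \<sigma>) {s \<in> \<sigma> ` carrier A. \<exists>g\<in>G. \<sigma> g \<preceq> s}"
  unfolding bl_filter_state_image_iff
proof (intro conjI ballI impI, goal_cases)
  case 1
  then show ?case
    using bl_filter_one[OF G] sigma_one le_refl by force
next
  case 2
  then show ?case by blast
next
  case (3 x y)
  then obtain g h where gh: "g \<in> G" "h \<in> G" "\<sigma> g \<preceq> x" "\<sigma> h \<preceq> y" by blast
  obtain a b where ab: "a \<in> carrier A" "b \<in> carrier A" "x = \<sigma> a" "y = \<sigma> b" using 3 by blast
  have c: "g \<in> carrier A" "h \<in> carrier A" using gh bl_filter_subset[OF G] by auto
  have "x \<otimes> y = \<sigma> (a \<otimes> b)" using ab by (simp add: sigma_mult)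
  moreover have "\<sigma> (g \<otimes> h) \<preceq> x \<otimes> y"
    using c gh ab by (simp add: sigma_mult mult_mono sigma_mem)
  ultimately show ?case using ab gh bl_filter_mult[OF G] by blast
next
  case (4 x y)
  then obtain g where g: "g \<in> G" "\<sigma> g \<preceq> x" by blast
  then have "\<sigma> g \<preceq> y"
    using 4 bl_filter_subset[OF G] sigma_mem le_trans[of "\<sigma> g" x y] by blast
  then show ?case using g 4 by blast
qed

lemma state_simple_iff_maximal_Ker:
  "state_simple A \<sigma> \<longleftrightarrow> bl_maximal_filter A (state_Ker A \<sigma>)"
proof
  assume simple: "state_simple A \<sigma>"
  then have "\<zero> \<notin> state_Ker A \<sigma>"
    by (simp add: state_simple_iff state_Ker_def sigma_zero)
  then have "bl_proper_filter A (state_Ker A \<sigma>)"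
    unfolding bl_proper_filter_def using bl_filter_state_Ker bl_filter_zero_iff by blast
  moreover have "\<not> state_Ker A \<sigma> \<subset> G" if "bl_proper_filter A G" for G
  proof
    assume sub: "state_Ker A \<sigma> \<subset> G"
    have G: "bl_filter A G" "\<zero> \<notin> G"
      using that bl_filter_zero_iff unfolding bl_proper_filter_def by auto
    let ?U = "{s \<in> \<sigma> ` carrier A. \<exists>g\<in>G. \<sigma> g \<preceq> s}"
    have U: "\<sigma> g \<in> ?U" if "g \<in> G" for g
      using that bl_filter_subset[OF G(1)] le_refl sigma_mem by blast
    have "?U \<noteq> {\<one>}"
    proof
      assume "?U = {\<one>}"
      then have "G \<subseteq> state_Ker A \<sigma>"
        using U bl_filter_subset[OF G(1)] by (auto simp: state_Ker_def)
      then show False using sub by blast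
    qed
    then have "?U = \<sigma> ` carrier A"
      using simple bl_filter_image_up[OF G(1)] unfolding state_simple_iff by blast
    moreover have "\<zero> \<in> \<sigma> ` carrier A"
      using sigma_zero zero_closed by (metis imageI)
    ultimately obtain g where g: "g \<in> G" "\<sigma> g \<preceq> \<zero>" by blast
    then have gc: "g \<in> carrier A" using bl_filter_subset[OF G(1)] by blast
    \<comment> \<open>Here \<open>\<sigma> g = \<zero>\<close>, so the value is
      \<open>\<zero> \<rightharpoonup> \<zero>\<close>.\<close>
    then have "\<sigma> (g \<rightharpoonup> \<zero>) = \<one>"
      using g by (simp add: sigma_neg le_zero_iff sigma_mem imp_self zero_closed)
    then have "g \<rightharpoonup> \<zero> \<in> G"
      using sub gc zero_closed imp_closed by (auto simp: state_Ker_def)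
    then have "g \<otimes> (g \<rightharpoonup> \<zero>) \<in> G" using g bl_filter_mult[OF G(1)] by blast
    then have "\<zero> \<in> G"
      using bl_filter_up[OF G(1)] modus_ponens gc zero_closed by blast
    then show False using G by blast
  qed
  ultimately show "bl_maximal_filter A (state_Ker A \<sigma>)"
    unfolding bl_maximal_filter_def by blast
next
  assume max: "bl_maximal_filter A (state_Ker A \<sigma>)"
  then have "\<zero> \<notin> state_Ker A \<sigma>"
    unfolding bl_maximal_filter_def bl_proper_filter_def using bl_filter_zero_iff by blast
  then have "\<zero> \<noteq> \<one>" by (auto simp: state_Ker_def sigma_zero zero_closed)
  moreover have "F = {\<one>} \<or> F = \<sigma> ` carrier A" if F: "bl_filter (state_image A \<sigma>) F" for F
  proof -
    let ?H = "{x \<in> carrier A. \<sigma> x \<in> F}"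
    have H: "bl_filter A ?H" using bl_filter_vimage[OF F] .
    have sub: "F \<subseteq> \<sigma> ` carrier A" using F unfolding bl_filter_state_image_iff by blast
    have one: "\<one> \<in> F" using bl_filter_one[OF H] by (simp add: sigma_one)
    then have "state_Ker A \<sigma> \<subseteq> ?H" by (auto simp: state_Ker_def)
    \<comment> \<open>Maximality leaves no proper filter strictly above the kernel.\<close>
    then have "?H = carrier A \<or> ?H = state_Ker A \<sigma>"
      using max H unfolding bl_maximal_filter_def bl_proper_filter_def by blast
    then show ?thesis
    proof
      assume "?H = carrier A"
      then show ?thesis using sub by blast
    next
      assume K: "?H = state_Ker A \<sigma>"
      have "s = \<one>" if s: "s \<in> F" for s
      proof -
        obtain a where a: "a \<in> carrier A" "s = \<sigma> a" using s sub by blast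
        then have "a \<in> state_Ker A \<sigma>" using K s by blast
        then show ?thesis using a by (simp add: state_Ker_def)
      qed
      then show ?thesis using one by blast
    qed
  qed
  ultimately show "state_simple A \<sigma>" unfolding state_simple_iff by blast
qed

text \<open>Every maximal filter contains \<open>\<one>\<close>, so
  \<open>\<sigma> x = \<one>\<close> already puts \<open>\<sigma> x\<close> into the radical, and
  faithfulness applies to \<open>x\<close>.\<close>

lemma radical_faithful_Ker_subset_Rad:
  assumes "radical_faithful A \<sigma>"
  shows "state_Ker A \<sigma> \<subseteq> bl_Rad A"
proof -
  have "\<one> \<in> bl_Rad A"
    using bl_filter_one
    by (auto simp: bl_Rad_def bl_maximal_filter_def bl_proper_filter_def)
  then show ?thesis
    using assms by (auto simp: radical_faithful_def state_Ker_def)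
qed

end

theorem theorem7p9:
  fixes A :: "('a, 'm) bl_struct_scheme" and \<sigma> :: "'a \<Rightarrow> 'a"
  assumes "state_morphism_bl_algebra A \<sigma>"
    and "radical_faithful A \<sigma>"
  shows "state_simple A \<sigma> \<longleftrightarrow> bl_local A \<and> state_Ker A \<sigma> = bl_Rad A"
proof -
  interpret state_morphism_bl_algebra A \<sigma> by fact
  show ?thesis
    unfolding state_simple_iff_maximal_Ker
  proof
    assume max: "bl_maximal_filter A (state_Ker A \<sigma>)"
    \<comment> \<open>The inclusion of the radical in the kernel holds because the kernel is itself
      one of the intersected maximal filters.\<close>
    have Ker: "state_Ker A \<sigma> = bl_Rad A"
      using max radical_faithful_Ker_subset_Rad[OF assms(2)] by (auto simp: bl_Rad_def)
    have "F = state_Ker A \<sigma>" if F: "bl_maximal_filter A F" for F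
    proof -
      have "state_Ker A \<sigma> \<subseteq> F" using Ker F by (auto simp: bl_Rad_def)
      then show ?thesis using max F unfolding bl_maximal_filter_def by blast
    qed
    then have "bl_local A" unfolding bl_local_def using max by blast
    then show "bl_local A \<and> state_Ker A \<sigma> = bl_Rad A" using Ker by blast
  next
    assume R: "bl_local A \<and> state_Ker A \<sigma> = bl_Rad A"
    then obtain M where M: "bl_maximal_filter A M" "\<And>F. bl_maximal_filter A F \<Longrightarrow> F = M"
      unfolding bl_local_def by blast
    then have "{F. bl_maximal_filter A F} = {M}" by blast
    \<comment> \<open>This absorbs the intersection with the carrier in
      \<open>bl_Rad\<close>.\<close>
    moreover have "M \<subseteq> carrier A"
      using M(1) by (auto simp: bl_maximal_filter_def bl_proper_filter_def bl_filter_def)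
    ultimately have "bl_Rad A = M" by (auto simp: bl_Rad_def)
    then show "bl_maximal_filter A (state_Ker A \<sigma>)" using R M(1) by simp
  qed
qed

end
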